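(* Let $G$ be a finite simple connected graph of order $n\ge 5$ and size $m$. If $G$ has a maximum matching $M$ with $|M|=k$, then $\chi'_L(G)\le m-k+1$. This bound is attained by the cycle $C_5$, the path $P_5$, the star $K_{1,n-1}$, and the double star $S_{p,1}$.
   Context: A maximum matching is a matching of largest possible size. $C_5$, $P_5$ are the cycle and path on five vertices; $K_{1,n-1}$ is the star with $n-1$ edges; the double star $S_{p,1}$ is the tree consisting of two adjacent vertices $v,u$ where $v$ has $p$ further leaf neighbors and $u$ has one further leaf neighbor. For a proper edge coloring $c:E(G)\to\{1,\dots,k\}$ of $G$, let $\pi=(\mathcal{C}_1,\dots,\mathcal{C}_k)$ be the ordered partition of $E(G)$ into color classes. For a vertex $v$ and an edge $e=xy$, $d(v,e)=\min\{d(v,x),d(v,y)\}$, and $d(v,\mathcal{C}_i)=\min\{d(v,e): e\in\mathcal{C}_i\}$. The edge color code of $v$ is $c_\pi(v)=(d(v,\mathcal{C}_1),\dots,d(v,\mathcal{C}_k))$. The coloring is an edge-locating coloring if distinct vertices have distinct edge color codes; $\chi'_L(G)$ is the minimum number of colors in an edge-locating coloring of $G$. *)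

theory Defs
  imports Main
begin

section \<open>Finite simple graphs\<close>

record 'a ugraph =
  verts :: "'a set"
  edges :: "'a set set"

definition simple_graph :: "'a ugraph \<Rightarrow> bool" where
  "simple_graph G \<longleftrightarrow> finite (verts G) \<and>
     edges G \<subseteq> {{u, v} | u v. u \<in> verts G \<and> v \<in> verts G \<and> u \<noteq> v}"

definition adj_rel :: "'a ugraph \<Rightarrow> ('a \<times> 'a) set" where
  "adj_rel G = {(u, v). {u, v} \<in> edges G}"

definition connected_graph :: "'a ugraph \<Rightarrow> bool" where
  "connected_graph G \<longleftrightarrow> simple_graph G \<and> verts G \<noteq> {} \<and>
     (\<forall>u\<in>verts G. \<forall>v\<in>verts G. (u, v) \<in> (adj_rel G)\<^sup>*)"

text \<open>The length of a shortest walk; meaningful only when \<open>v\<close> is reachable from \<open>u\<close>,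
  which is always the case below since only connected graphs are considered.\<close>

definition vdist :: "'a ugraph \<Rightarrow> 'a \<Rightarrow> 'a \<Rightarrow> nat" where
  "vdist G u v = (LEAST l. (u, v) \<in> adj_rel G ^^ l)"

definition edge_dist :: "'a ugraph \<Rightarrow> 'a \<Rightarrow> 'a set \<Rightarrow> nat" where
  "edge_dist G v e = Min (vdist G v ` e)"

definition class_dist :: "'a ugraph \<Rightarrow> 'a \<Rightarrow> 'a set set \<Rightarrow> nat" where
  "class_dist G v C = Min (edge_dist G v ` C)"


section \<open>Matchings\<close>

definition matching :: "'a ugraph \<Rightarrow> 'a set set \<Rightarrow> bool" where
  "matching G M \<longleftrightarrow> M \<subseteq> edges G \<and> pairwise disjnt M"

definition maximum_matching :: "'a ugraph \<Rightarrow> 'a set set \<Rightarrow> bool" where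
  "maximum_matching G M \<longleftrightarrow> matching G M \<and> (\<forall>M'. matching G M' \<longrightarrow> card M' \<le> card M)"


section \<open>Edge-locating colorings\<close>

text \<open>All of the colors \<open>1, \<dots>, k\<close> are used, because the color classes form a partition of
  the edge set, so none of them is empty. In particular the minimum in \<open>class_dist\<close> is
  always taken over a nonempty set.\<close>

definition proper_edge_coloring :: "'a ugraph \<Rightarrow> nat \<Rightarrow> ('a set \<Rightarrow> nat) \<Rightarrow> bool" where
  "proper_edge_coloring G k c \<longleftrightarrow> c ` edges G = {1..k} \<and>
     (\<forall>e\<in>edges G. \<forall>f\<in>edges G. e \<noteq> f \<and> e \<inter> f \<noteq> {} \<longrightarrow> c e \<noteq> c f)"

definition color_class :: "'a ugraph \<Rightarrow> ('a set \<Rightarrow> nat) \<Rightarrow> nat \<Rightarrow> 'a set set" where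
  "color_class G c i = {e \<in> edges G. c e = i}"

definition edge_color_code :: "'a ugraph \<Rightarrow> nat \<Rightarrow> ('a set \<Rightarrow> nat) \<Rightarrow> 'a \<Rightarrow> nat list" where
  "edge_color_code G k c v = map (\<lambda>i. class_dist G v (color_class G c i)) [1..<Suc k]"

definition edge_locating_coloring :: "'a ugraph \<Rightarrow> nat \<Rightarrow> ('a set \<Rightarrow> nat) \<Rightarrow> bool" where
  "edge_locating_coloring G k c \<longleftrightarrow>
     proper_edge_coloring G k c \<and> inj_on (edge_color_code G k c) (verts G)"

text \<open>For a connected graph on at least three vertices the minimum exists: giving all edges
  different colors is an edge-locating coloring.\<close>

definition edge_locating_chromatic_number :: "'a ugraph \<Rightarrow> nat" where
  "edge_locating_chromatic_number G = (LEAST k. \<exists>c. edge_locating_coloring G k c)"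

definition attains_matching_bound :: "'a ugraph \<Rightarrow> bool" where
  "attains_matching_bound G \<longleftrightarrow> connected_graph G \<and> 5 \<le> card (verts G) \<and>
     (\<exists>M. maximum_matching G M \<and>
          edge_locating_chromatic_number G = card (edges G) - card M + 1)"


section \<open>Special graphs\<close>

definition path_graph :: "nat \<Rightarrow> nat ugraph" where
  "path_graph n = \<lparr>verts = {..<n}, edges = {{i, Suc i} | i. Suc i < n}\<rparr>"

definition cycle_graph :: "nat \<Rightarrow> nat ugraph" where
  "cycle_graph n = \<lparr>verts = {..<n}, edges = {{i, Suc i mod n} | i. i < n}\<rparr>"

text \<open>The star with \<open>q\<close> edges, and the double star in which the adjacent centers \<open>0\<close> and
  \<open>1\<close> have \<open>p\<close> and \<open>q\<close> leaf neighbors, respectively.\<close>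

definition star_graph :: "nat \<Rightarrow> nat ugraph" where
  "star_graph q = \<lparr>verts = {..q}, edges = {{0, i} | i. i \<in> {1..q}}\<rparr>"

definition double_star :: "nat \<Rightarrow> nat \<Rightarrow> nat ugraph" where
  "double_star p q = \<lparr>verts = {..<p + q + 2},
     edges = {{0, 1}} \<union> {{0, i} | i. i \<in> {2..<p + 2}}
                      \<union> {{1, j} | j. j \<in> {p + 2..<p + q + 2}}\<rparr>"

end

theory Submission
  imports Defs
begin

text \<open>Give all edges of \<open>M\<close> one color and all other edges private colors. If \<open>u \<noteq> v\<close> had
  equal codes, then every edge outside \<open>M\<close> would contain both or neither of them, and would be
  within distance one of both or neither. By maximality both are then matched, and together with
  their partners they form a set closed under adjacency, so the graph has at most four vertices.
  Sharpness for stars and double stars comes from the maximum degree; for \<open>P\<^sub>5\<close> and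
  \<open>C\<^sub>5\<close> one fewer color always produces two vertices with equal codes.\<close>

section \<open>Distances in connected graphs\<close>

lemma edgeE:
  assumes "connected_graph G" "e \<in> edges G"
  obtains x y where "e = {x, y}" "x \<noteq> y" "x \<in> verts G" "y \<in> verts G"
  using assms unfolding connected_graph_def simple_graph_def by blast

lemma edge_subset_verts: "connected_graph G \<Longrightarrow> e \<in> edges G \<Longrightarrow> e \<subseteq> verts G"
  by (auto elim: edgeE)

lemma Union_edges_verts:
  "connected_graph G \<Longrightarrow> C \<subseteq> edges G \<Longrightarrow> x \<in> \<Union>C \<Longrightarrow> x \<in> verts G"
  using edge_subset_verts by fastforce

lemma finite_edges:
  assumes "connected_graph G"
  shows "finite (edges G)"
proof (rule finite_subset)
  show "edges G \<subseteq> Pow (verts G)" using edge_subset_verts[OF assms] by blast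
  show "finite (Pow (verts G))" using assms by (simp add: connected_graph_def simple_graph_def)
qed

lemma vdist_le:
  "(u, v) \<in> adj_rel G ^^ l \<Longrightarrow> vdist G u v \<le> l"
  unfolding vdist_def by (rule Least_le)

text \<open>Connectedness supplies some walk, so the \<open>LEAST\<close> in \<open>vdist\<close> is
  attained rather than unspecified.\<close>

lemma vdist_relpow:
  assumes "connected_graph G" "u \<in> verts G" "v \<in> verts G"
  shows "(u, v) \<in> adj_rel G ^^ vdist G u v"
proof -
  have "(u, v) \<in> (adj_rel G)\<^sup>*" using assms by (simp add: connected_graph_def)
  then obtain l where "(u, v) \<in> adj_rel G ^^ l" by (auto simp: rtrancl_power)
  then show ?thesis unfolding vdist_def by (rule LeastI)
qed

lemma vdist_eq_0_iff:
  assumes "connected_graph G" "u \<in> verts G" "v \<in> verts G"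
  shows "vdist G u v = 0 \<longleftrightarrow> u = v"
  using vdist_relpow[OF assms] vdist_le[of u v 0 G] by auto

lemma vdist_le_1_iff:
  assumes "connected_graph G" "u \<in> verts G" "v \<in> verts G"
  shows "vdist G u v \<le> 1 \<longleftrightarrow> u = v \<or> {u, v} \<in> edges G"
proof
  assume "vdist G u v \<le> 1"
  then consider "vdist G u v = 0" | "vdist G u v = 1" by linarith
  then show "u = v \<or> {u, v} \<in> edges G"
    using vdist_relpow[OF assms] by cases (auto simp: adj_rel_def)
next
  assume "u = v \<or> {u, v} \<in> edges G"
  then show "vdist G u v \<le> 1"
    using vdist_le[of u v 0 G] vdist_le[of u v 1 G] by (auto simp: adj_rel_def)
qed

text \<open>Both nested minima run over finite nonempty sets, so \<open>Min_le_iff\<close> applies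
  twice. Of the color codes, only the thresholds 0 and 1 are used below.\<close>

lemma class_dist_le_iff:
  assumes "connected_graph G" "C \<subseteq> edges G" "C \<noteq> {}"
  shows "class_dist G v C \<le> l \<longleftrightarrow> (\<exists>x\<in>\<Union>C. vdist G v x \<le> l)"
proof -
  have fin: "finite C" using finite_edges[OF assms(1)] assms(2) finite_subset by blast
  have e: "finite e \<and> e \<noteq> {}" if "e \<in> C" for e
    using edgeE[OF assms(1), of e] assms(2) that by blast
  have "class_dist G v C \<le> l \<longleftrightarrow> (\<exists>e\<in>C. edge_dist G v e \<le> l)"
    unfolding class_dist_def using fin assms(3) by (simp add: Min_le_iff)
  also have "\<dots> \<longleftrightarrow> (\<exists>e\<in>C. \<exists>x\<in>e. vdist G v x \<le> l)"
    unfolding edge_dist_def using e by (simp add: Min_le_iff)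
  also have "\<dots> \<longleftrightarrow> (\<exists>x\<in>\<Union>C. vdist G v x \<le> l)" by blast
  finally show ?thesis .
qed

lemma class_dist_eq_0_iff:
  assumes "connected_graph G" "v \<in> verts G" "C \<subseteq> edges G" "C \<noteq> {}"
  shows "class_dist G v C = 0 \<longleftrightarrow> v \<in> \<Union>C"
proof -
  have "vdist G v x = 0 \<longleftrightarrow> v = x" if "x \<in> \<Union>C" for x
    by (rule vdist_eq_0_iff[OF assms(1,2) Union_edges_verts[OF assms(1,3) that]])
  then show ?thesis using class_dist_le_iff[OF assms(1,3,4), of v 0] by simp
qed

lemma class_dist_le_1_iff:
  assumes "connected_graph G" "v \<in> verts G" "C \<subseteq> edges G" "C \<noteq> {}"
  shows "class_dist G v C \<le> 1 \<longleftrightarrow> (\<exists>x\<in>\<Union>C. v = x \<or> {v, x} \<in> edges G)"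
proof -
  have "vdist G v x \<le> 1 \<longleftrightarrow> v = x \<or> {v, x} \<in> edges G" if "x \<in> \<Union>C" for x
    by (rule vdist_le_1_iff[OF assms(1,2) Union_edges_verts[OF assms(1,3) that]])
  then show ?thesis using class_dist_le_iff[OF assms(1,3,4), of v 1] by simp
qed

text \<open>No walk from \<open>u\<close> can leave \<open>S\<close>. This turns closure arguments
  into bounds on the order of the graph.\<close>

lemma adjacency_closed_superset:
  assumes "connected_graph G" "u \<in> verts G" "u \<in> S"
    and closed: "\<And>x y. x \<in> S \<Longrightarrow> {x, y} \<in> edges G \<Longrightarrow> y \<in> S"
  shows "verts G \<subseteq> S"
proof
  fix w assume "w \<in> verts G"
  then have "(u, w) \<in> (adj_rel G)\<^sup>*" using assms by (simp add: connected_graph_def)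
  then show "w \<in> S"
    by (induction rule: rtrancl_induct) (use assms(3) closed in \<open>auto simp: adj_rel_def\<close>)
qed

text \<open>Adjacency is symmetric, so any two vertices are joined by a walk through the root
  \<open>r\<close>.\<close>

lemma connected_graphI:
  assumes "simple_graph G" "r \<in> verts G"
    and reach: "\<And>v. v \<in> verts G \<Longrightarrow> (r, v) \<in> (adj_rel G)\<^sup>*"
  shows "connected_graph G"
proof -
  have "sym (adj_rel G)" by (auto simp: sym_def adj_rel_def insert_commute)
  then have "sym ((adj_rel G)\<^sup>*)" by (rule sym_rtrancl)
  then have "(u, v) \<in> (adj_rel G)\<^sup>*" if "u \<in> verts G" "v \<in> verts G" for u v
    using reach[OF that(1)] reach[OF that(2)] by (meson symD rtrancl_trans)
  then show ?thesis using assms by (auto simp: connected_graph_def)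
qed


section \<open>Matchings\<close>

lemma matching_edge_eq:
  "matching G M \<Longrightarrow> e \<in> M \<Longrightarrow> f \<in> M \<Longrightarrow> x \<in> e \<Longrightarrow> x \<in> f \<Longrightarrow> e = f"
  unfolding matching_def pairwise_def disjnt_def by blast

lemma finite_matching: "connected_graph G \<Longrightarrow> matching G M \<Longrightarrow> finite M"
  using finite_edges finite_subset unfolding matching_def by blast

text \<open>Otherwise the edge could be added to \<open>M\<close>, giving a larger matching.\<close>

lemma maximum_matching_meets:
  assumes "connected_graph G" "maximum_matching G M" "e \<in> edges G"
  shows "e \<inter> \<Union>M \<noteq> {}"
proof
  assume disj: "e \<inter> \<Union>M = {}"
  have M: "matching G M" using assms by (simp add: maximum_matching_def)
  have "e \<noteq> {}" using edgeE[OF assms(1,3)] by blast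
  then have "e \<notin> M" using disj by blast
  have "matching G (insert e M)"
    using M assms(3) disj unfolding matching_def pairwise_insert disjnt_def by blast
  then have "card (insert e M) \<le> card M" using assms by (simp add: maximum_matching_def)
  then show False using \<open>e \<notin> M\<close> finite_matching[OF assms(1) M] by simp
qed

text \<open>Weak duality of matchings and vertex covers: each matching edge picks a vertex of
  \<open>S\<close>, and disjoint edges pick different ones. The covers used later are the centers of
  stars and double stars.\<close>

lemma card_matching_le_cover:
  assumes "matching G M" "finite S" "\<And>e. e \<in> edges G \<Longrightarrow> e \<inter> S \<noteq> {}"
  shows "card M \<le> card S"
proof -
  obtain f where f: "\<And>e. e \<in> edges G \<Longrightarrow> f e \<in> e \<inter> S"
    using bchoice[of "edges G" "\<lambda>e x. x \<in> e \<inter> S"] assms(3) by blast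
  have ME: "M \<subseteq> edges G" using assms(1) by (simp add: matching_def)
  have "inj_on f M"
  proof (rule inj_onI)
    fix d e assume "d \<in> M" "e \<in> M" "f d = f e"
    then show "d = e"
      using f[of d] f[of e] ME matching_edge_eq[OF assms(1), of d e "f d"] by auto
  qed
  moreover have "f ` M \<subseteq> S" using f ME by blast
  ultimately show ?thesis using assms(2) card_inj_on_le by blast
qed

lemma double_card_matching_le:
  assumes "connected_graph G" "matching G M"
  shows "2 * card M \<le> card (verts G)"
proof -
  have fin: "finite (verts G)"
    using assms by (simp add: connected_graph_def simple_graph_def)
  have ME: "M \<subseteq> edges G" using assms(2) by (simp add: matching_def)
  have card2: "card e = 2 \<and> finite e" if "e \<in> M" for e
    using edgeE[OF assms(1), of e] ME that by (metis card_2_iff finite.simps subsetD)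
  have "card (\<Union>M) = sum card M"
    by (rule card_Union_disjoint) (use assms(2) card2 in \<open>auto simp: matching_def\<close>)
  also have "\<dots> = 2 * card M" using card2 by simp
  finally have "2 * card M = card (\<Union>M)" by simp
  also have "\<dots> \<le> card (verts G)"
    using ME edge_subset_verts[OF assms(1)] fin by (intro card_mono) blast+
  finally show ?thesis .
qed


section \<open>The upper bound\<close>

text \<open>This is half of the closure claim, for the neighbors of \<open>u\<close> and of its
  partner; the other half follows by exchanging \<open>u\<close> and \<open>v\<close>. The partners
  may be \<open>v\<close> and \<open>u\<close> themselves.\<close>

lemma indistinguishable_closed:
  assumes mat: "matching G M"
    and uv: "u \<noteq> v" "{u, u'} \<in> M" "{v, v'} \<in> M"
    and inc: "\<And>e. e \<in> edges G - M \<Longrightarrow> u \<in> e \<longleftrightarrow> v \<in> e"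
    and near: "\<And>e. e \<in> edges G - M \<Longrightarrow>
      (\<exists>x\<in>e. u = x \<or> {u, x} \<in> edges G) \<longleftrightarrow> (\<exists>x\<in>e. v = x \<or> {v, x} \<in> edges G)"
    and x: "x = u \<or> x = u'" and xy: "{x, y} \<in> edges G"
  shows "y \<in> {u, u', v, v'}"
proof -
  have ME: "M \<subseteq> edges G" using mat by (simp add: matching_def)
  \<comment> \<open>An edge at \<open>a\<close> is either the matching edge of \<open>a\<close> or
    lies outside \<open>M\<close> and then also contains \<open>w\<close>. So \<open>a\<close> has
    at most these two neighbors.\<close>
  have nb: "b = a' \<or> b = w"
    if "{a, b} \<in> edges G" "{a, a'} \<in> M" "a \<noteq> w"
      "\<And>e. e \<in> edges G - M \<Longrightarrow> a \<in> e \<longleftrightarrow> w \<in> e" for a a' b w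
  proof (cases "{a, b} \<in> M")
    case True
    then have "{a, b} = {a, a'}" using matching_edge_eq[OF mat _ that(2), of "{a, b}" a] by simp
    then show ?thesis by (auto simp: doubleton_eq_iff)
  next
    case False
    then have "w \<in> {a, b}" using that(1) that(4)[of "{a, b}"] by simp
    then show ?thesis using that(3) by auto
  qed
  have nbu: "b = u' \<or> b = v" if "{u, b} \<in> edges G" for b
    using nb[OF that uv(2,1)] inc by blast
  have nbv: "b = v' \<or> b = u" if "{v, b} \<in> edges G" for b
    by (rule nb[OF that uv(3) uv(1)[symmetric]]) (rule inc[symmetric])
  show ?thesis
  proof (cases "x = u")
    case True
    then show ?thesis using nbu xy by blast
  next
    case False
    then have [simp]: "x = u'" using x by simp
    show ?thesis
    proof (cases "{x, y} \<in> M")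
      case True
      then have "{x, y} = {u, u'}" using matching_edge_eq[OF mat _ uv(2), of "{x, y}" u'] by simp
      then show ?thesis by (auto simp: doubleton_eq_iff)
    next
      case nM: False
      \<comment> \<open>The nonmatching edge \<open>{u', y}\<close> is within distance one of
        \<open>u\<close> through \<open>u'\<close>, hence by \<open>near\<close> also of
        \<open>v\<close>, whose neighbors are already known.\<close>
      have "\<exists>z\<in>{x, y}. u = z \<or> {u, z} \<in> edges G" using uv(2) ME by auto
      then obtain z where z: "z \<in> {x, y}" "v = z \<or> {v, z} \<in> edges G"
        using near[of "{x, y}"] xy nM by blast
      have zS: "z = v \<or> z = v' \<or> z = u" using z(2) nbv by blast
      show ?thesis
      proof (cases "z = y")
        case True
        then show ?thesis using zS by auto
      next
        case False
        \<comment> \<open>Now \<open>u'\<close> is one of \<open>v\<close>, \<open>v'\<close>,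
          \<open>u\<close>. A shared partner would merge the two matching edges, and
          \<open>u' = u\<close> is excluded by the case, so \<open>u' = v\<close> and
          \<open>nbv\<close> applies to \<open>y\<close>.\<close>
        then have "z = u'" using z(1) by simp
        moreover have "u' \<noteq> v'"
        proof
          assume "u' = v'"
          then have "{u, u'} = {v, u'}"
            using matching_edge_eq[OF mat uv(2,3), of u'] by simp
          then show False using uv(1) by (auto simp: doubleton_eq_iff)
        qed
        ultimately have "u' = v" using zS \<open>x \<noteq> u\<close> by auto
        then show ?thesis using nbv xy by auto
      qed
    qed
  qed
qed

text \<open>The three conditions \<open>inc\<close>, \<open>near\<close> and \<open>matched\<close>
  are the part of code equality that is needed, stated without colors. The order must exceed four
  because the closed set consists of two vertices and their partners.\<close>

lemma distinguishable:
  assumes con: "connected_graph G" and max: "maximum_matching G M"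
    and n: "5 \<le> card (verts G)" and uV: "u \<in> verts G"
    and inc: "\<And>e. e \<in> edges G - M \<Longrightarrow> u \<in> e \<longleftrightarrow> v \<in> e"
    and near: "\<And>e. e \<in> edges G - M \<Longrightarrow>
      (\<exists>x\<in>e. u = x \<or> {u, x} \<in> edges G) \<longleftrightarrow> (\<exists>x\<in>e. v = x \<or> {v, x} \<in> edges G)"
    and matched: "u \<in> \<Union>M \<longleftrightarrow> v \<in> \<Union>M"
  shows "u = v"
proof (rule ccontr)
  assume uv: "u \<noteq> v"
  have mat: "matching G M" using max by (simp add: maximum_matching_def)
  then have ME: "M \<subseteq> edges G" by (simp add: matching_def)
  \<comment> \<open>The four vertices may coincide, so the bound goes through the length of a
    list.\<close>
  have small: False if "verts G \<subseteq> {a, b, c, d}" for a b c d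
  proof -
    have "card (verts G) \<le> card (set [a, b, c, d])" using that by (intro card_mono) auto
    also have "\<dots> \<le> 4" using card_length[of "[a, b, c, d]"] by simp
    finally show False using n by simp
  qed
  have partner: "\<exists>a'. {a, a'} \<in> M" if "a \<in> \<Union>M" for a
  proof -
    obtain e where e: "e \<in> M" "a \<in> e" using \<open>a \<in> \<Union>M\<close> by blast
    then obtain x y where "e = {x, y}" using edgeE[OF con, of e] ME by blast
    then show ?thesis using e by (auto simp: insert_commute)
  qed
  \<comment> \<open>If \<open>u\<close> and \<open>v\<close> were both unmatched, any edge at
    \<open>u\<close> would lie outside \<open>M\<close>, hence be \<open>{u, v}\<close>, and would
    miss every matched vertex.\<close>
  have "u \<in> \<Union>M"
  proof (rule ccontr)
    assume um: "u \<notin> \<Union>M"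
    then have vm: "v \<notin> \<Union>M" using matched by simp
    have "\<exists>y. {u, y} \<in> edges G"
    proof (rule ccontr)
      assume "\<not> ?thesis"
      then have "verts G \<subseteq> {u}" by (intro adjacency_closed_superset[OF con uV]) auto
      then show False using small[of u u u u] by simp
    qed
    then obtain y where y: "{u, y} \<in> edges G" by blast
    moreover have "{u, y} \<notin> M" using um by blast
    ultimately have "v \<in> {u, y}" using inc[of "{u, y}"] by simp
    then have "y = v" using uv by simp
    then show False using maximum_matching_meets[OF con max y] um vm by blast
  qed
  then obtain u' where u': "{u, u'} \<in> M" using partner by blast
  obtain v' where v': "{v, v'} \<in> M" using partner \<open>u \<in> \<Union>M\<close> matched by blast
  have "y \<in> {u, u', v, v'}" if "x \<in> {u, u', v, v'}" and xy: "{x, y} \<in> edges G" for x y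
  proof (cases "x = u \<or> x = u'")
    case True
    then show ?thesis
      by (intro indistinguishable_closed[OF mat uv u' v' _ _ _ xy] inc near)
  next
    case False
    then have "x = v \<or> x = v'" using that(1) by auto
    then have "y \<in> {v, v', u, u'}"
      by (intro indistinguishable_closed[OF mat uv[symmetric] v' u' _ _ _ xy]
          inc[symmetric] near[symmetric])
    then show ?thesis by auto
  qed
  then have "verts G \<subseteq> {u, u', v, v'}" by (intro adjacency_closed_superset[OF con uV]) auto
  then show False by (rule small)
qed

text \<open>Edges of \<open>M\<close> are disjoint, so they may share color 1; the others receive
  the colors \<open>2..k\<close> bijectively. Equal codes then yield the hypotheses of
  \<open>distinguishable\<close>.\<close>

lemma exists_edge_locating_coloring:
  assumes con: "connected_graph G" and max: "maximum_matching G M"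
    and n: "5 \<le> card (verts G)"
  shows "\<exists>c. edge_locating_coloring G (card (edges G) - card M + 1) c"
proof -
  define k where "k = card (edges G) - card M + 1"
  have mat: "matching G M" using max by (simp add: maximum_matching_def)
  then have ME: "M \<subseteq> edges G" by (simp add: matching_def)
  have finE: "finite (edges G)" by (rule finite_edges[OF con])
  have finM: "finite M" by (rule finite_matching[OF con mat])
  have "edges G \<noteq> {}"
  proof
    assume "edges G = {}"
    moreover obtain u where u: "u \<in> verts G" using con by (auto simp: connected_graph_def)
    ultimately have "verts G \<subseteq> {u}" by (intro adjacency_closed_superset[OF con]) auto
    then have "card (verts G) \<le> card {u}" by (intro card_mono) auto
    then show False using n by simp
  qed
  \<comment> \<open>Without a matching edge color 1 would be missing from the required image
    \<open>{1..k}\<close>.\<close>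
  then have "M \<noteq> {}" using maximum_matching_meets[OF con max] by blast
  have "card (edges G - M) = card {2..k}" using card_Diff_subset[OF finM ME] by (simp add: k_def)
  then obtain h where h: "bij_betw h (edges G - M) {2..k}"
    using finite_same_card_bij[of "edges G - M" "{2..k}"] finE by auto
  define c where "c e = (if e \<in> M then 1 else h e)" for e
  have hk: "h e \<in> {2..k}" if "e \<in> edges G - M" for e using h that bij_betwE by blast
  have "c ` edges G = c ` M \<union> c ` (edges G - M)" using ME by blast
  also have "c ` M = {1}" using \<open>M \<noteq> {}\<close> by (auto simp: c_def)
  also have "c ` (edges G - M) = h ` (edges G - M)" by (rule image_cong) (auto simp: c_def)
  also have "\<dots> = {2..k}" using h by (simp add: bij_betw_def)
  also have "{1} \<union> {2..k} = {1..k}" by (auto simp: k_def)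
  finally have image: "c ` edges G = {1..k}" .
  have same: "e = f \<or> e \<in> M \<and> f \<in> M" if "e \<in> edges G" "f \<in> edges G" "c e = c f" for e f
  proof -
    have "inj_on h (edges G - M)" using h by (simp add: bij_betw_def)
    then show ?thesis using that hk[of e] hk[of f] by (auto simp: c_def inj_on_def split: if_splits)
  qed
  have proper: "proper_edge_coloring G k c"
    unfolding proper_edge_coloring_def using image same matching_edge_eq[OF mat] by blast
  have class1: "color_class G c 1 = M"
    using ME hk by (force simp: color_class_def c_def)
  have class2: "color_class G c (c e) = {e}" if "e \<in> edges G - M" for e
    using same that by (auto simp: color_class_def)
  have "u = v" if u: "u \<in> verts G" and v: "v \<in> verts G"
    and code: "edge_color_code G k c u = edge_color_code G k c v" for u v
  proof (rule distinguishable[OF con max n u])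
    have eq: "class_dist G u (color_class G c i) = class_dist G v (color_class G c i)"
      if "i \<in> {1..k}" for i
    proof -
      have "i \<in> set [1..<Suc k]" using that by auto
      then show ?thesis using code unfolding edge_color_code_def map_eq_conv by blast
    qed
    \<comment> \<open>A private color has the class \<open>{e}\<close>, so its code entry is the
      distance to \<open>e\<close> itself. Threshold 0 gives incidence, threshold 1
      nearness.\<close>
    have eqe: "class_dist G u {e} = class_dist G v {e}" if "e \<in> edges G - M" for e
    proof -
      have "c e \<in> {1..k}" using image that by blast
      from eq[OF this] show ?thesis unfolding class2[OF that] .
    qed
    show "u \<in> e \<longleftrightarrow> v \<in> e" if "e \<in> edges G - M" for e
      using eqe[OF that] class_dist_eq_0_iff[OF con u, of "{e}"]
        class_dist_eq_0_iff[OF con v, of "{e}"] that by auto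
    show "(\<exists>x\<in>e. u = x \<or> {u, x} \<in> edges G) \<longleftrightarrow> (\<exists>x\<in>e. v = x \<or> {v, x} \<in> edges G)"
      if "e \<in> edges G - M" for e
      using eqe[OF that] class_dist_le_1_iff[OF con u, of "{e}"]
        class_dist_le_1_iff[OF con v, of "{e}"] that by simp
    have "class_dist G u M = class_dist G v M" using eq[of 1] class1 by (simp add: k_def)
    then show "u \<in> \<Union>M \<longleftrightarrow> v \<in> \<Union>M"
      using class_dist_eq_0_iff[OF con u ME \<open>M \<noteq> {}\<close>] class_dist_eq_0_iff[OF con v ME \<open>M \<noteq> {}\<close>]
      by simp
  qed
  then have "inj_on (edge_color_code G k c) (verts G)" by (auto intro: inj_onI)
  then show ?thesis using proper unfolding edge_locating_coloring_def k_def by blast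
qed


section \<open>Sharpness\<close>

text \<open>The upper bound already supplies a coloring with \<open>card (edges G) - s + 1\<close>
  colors, so for each example only the matching number \<open>s\<close> and the lower bound on
  colors remain.\<close>

lemma attains_matching_boundI:
  assumes "connected_graph G" "5 \<le> card (verts G)" "matching G M" "card M = s"
    and "\<And>M'. matching G M' \<Longrightarrow> card M' \<le> s"
    and "\<And>k c. edge_locating_coloring G k c \<Longrightarrow> card (edges G) - s + 1 \<le> k"
  shows "attains_matching_bound G"
proof -
  have max: "maximum_matching G M" using assms by (simp add: maximum_matching_def)
  have "edge_locating_chromatic_number G = card (edges G) - card M + 1"
    unfolding edge_locating_chromatic_number_def
    using exists_edge_locating_coloring[OF assms(1) max assms(2)] assms(4,6)
    by (intro Least_equality) auto
  then show ?thesis using assms(1,2) max by (auto simp: attains_matching_bound_def)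
qed

text \<open>Edges through a common vertex meet pairwise, so their colors are all different.\<close>

lemma degree_le_colors:
  assumes "proper_edge_coloring G k c" "F \<subseteq> edges G" "\<And>e. e \<in> F \<Longrightarrow> v \<in> e"
  shows "card F \<le> k"
proof -
  have "inj_on c F"
  proof (rule inj_onI, rule ccontr)
    fix e f assume *: "e \<in> F" "f \<in> F" "c e = c f" "e \<noteq> f"
    then have "e \<inter> f \<noteq> {}" using assms(3) by blast
    then show False using * assms(1,2) unfolding proper_edge_coloring_def by blast
  qed
  moreover have "c ` F \<subseteq> {1..k}" using assms(1,2) unfolding proper_edge_coloring_def by blast
  ultimately show ?thesis using card_inj_on_le[of c F "{1..k}"] by simp
qed

text \<open>When every color occurs within distance one of \<open>u\<close> and of \<open>v\<close>,
  both codes consist of zeros and ones, with zeros exactly at the incident colors. Equal sets of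
  incident colors would then give equal codes.\<close>

lemma locating_distinguishes:
  assumes con: "connected_graph G" and loc: "edge_locating_coloring G k c"
    and uv: "u \<in> verts G" "v \<in> verts G" "u \<noteq> v"
    and nu: "{1..k} \<subseteq> c ` {e \<in> edges G. \<exists>x\<in>e. u = x \<or> {u, x} \<in> edges G}"
    and nv: "{1..k} \<subseteq> c ` {e \<in> edges G. \<exists>x\<in>e. v = x \<or> {v, x} \<in> edges G}"
  shows "c ` {e \<in> edges G. u \<in> e} \<noteq> c ` {e \<in> edges G. v \<in> e}"
proof
  assume img: "c ` {e \<in> edges G. u \<in> e} = c ` {e \<in> edges G. v \<in> e}"
  have "class_dist G u (color_class G c i) = class_dist G v (color_class G c i)"
    if i: "i \<in> {1..k}" for i
  proof -
    let ?C = "color_class G c i"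
    have C: "?C \<subseteq> edges G" "?C \<noteq> {}" using nu i unfolding color_class_def by blast+
    have "class_dist G u ?C \<le> 1" "class_dist G v ?C \<le> 1"
      unfolding class_dist_le_1_iff[OF con uv(1) C] class_dist_le_1_iff[OF con uv(2) C]
      using nu nv i unfolding color_class_def by blast+
    moreover have "w \<in> \<Union>?C \<longleftrightarrow> i \<in> c ` {e \<in> edges G. w \<in> e}" for w
      unfolding color_class_def by blast
    then have "class_dist G u ?C = 0 \<longleftrightarrow> class_dist G v ?C = 0"
      unfolding class_dist_eq_0_iff[OF con uv(1) C] class_dist_eq_0_iff[OF con uv(2) C]
      by (simp only: img)
    ultimately show ?thesis by linarith
  qed
  then have "edge_color_code G k c u = edge_color_code G k c v"
    by (auto simp: edge_color_code_def)
  then show False using loc uv by (auto simp: edge_locating_coloring_def inj_on_def)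
qed

lemma reachable_along_path:
  assumes "\<And>i. Suc i < n \<Longrightarrow> {i, Suc i} \<in> edges G" "v < n"
  shows "(0, v) \<in> (adj_rel G)\<^sup>*"
  using assms(2)
proof (induction v)
  case (Suc v)
  then have "(v, Suc v) \<in> adj_rel G" using assms(1) by (simp add: adj_rel_def)
  then show ?case using Suc by (simp add: rtrancl.rtrancl_into_rtrancl)
qed simp

section \<open>The cycle and the path on five vertices\<close>

lemma lessThan_5: "{..<5} = {0, 1, 2, 3, 4 :: nat}"
  by auto

lemma edges_cycle_5: "edges (cycle_graph 5) = {{0, 1}, {1, 2}, {2, 3}, {3, 4}, {4, 0}}"
proof -
  have "edges (cycle_graph 5) = (\<lambda>i. {i, Suc i mod 5}) ` {..<5}"
    by (auto simp: cycle_graph_def)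
  then show ?thesis unfolding lessThan_5 by (simp add: numeral_2_eq_2)
qed

lemma edges_path_5: "edges (path_graph 5) = {{0, 1}, {1, 2}, {2, 3}, {3, 4}}"
proof -
  have "edges (path_graph 5) = (\<lambda>i. {i, Suc i}) ` {..<4}"
    by (auto simp: path_graph_def)
  also have "{..<4} = {0, 1, 2, 3 :: nat}" by auto
  finally show ?thesis by (simp add: numeral_eq_Suc)
qed

lemma connected_cycle_5: "connected_graph (cycle_graph 5)"
proof (rule connected_graphI[where r = 0])
  have "verts (cycle_graph 5) = {0, 1, 2, 3, 4}" unfolding lessThan_5[symmetric]
    by (simp add: cycle_graph_def)
  then show "simple_graph (cycle_graph 5)"
    unfolding simple_graph_def edges_cycle_5 by fastforce
  show "0 \<in> verts (cycle_graph 5)" by (simp add: cycle_graph_def)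
  show "(0, v) \<in> (adj_rel (cycle_graph 5))\<^sup>*" if "v \<in> verts (cycle_graph 5)" for v
  proof (rule reachable_along_path)
    show "{i, Suc i} \<in> edges (cycle_graph 5)" if "Suc i < 5" for i
      using that by (auto simp: cycle_graph_def intro!: exI[of _ i])
    show "v < 5" using that by (simp add: cycle_graph_def)
  qed
qed

lemma connected_path:
  assumes "n > 0"
  shows "connected_graph (path_graph n)"
proof (rule connected_graphI[where r = 0])
  show "simple_graph (path_graph n)"
    by (force simp: simple_graph_def path_graph_def)
  show "0 \<in> verts (path_graph n)" using assms by (simp add: path_graph_def)
  show "(0, v) \<in> (adj_rel (path_graph n))\<^sup>*" if "v \<in> verts (path_graph n)" for v
    by (rule reachable_along_path[of n]) (use that in \<open>auto simp: path_graph_def\<close>)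
qed

text \<open>Around the cycle the colors read a, b, c, b, c. Both \<open>x\<close> and
  \<open>z\<close> are incident with b and c and adjacent to an end of the edge
  \<open>{v, w}\<close> colored a, so their codes agree. The vertices are variables to cover all
  rotations.\<close>

lemma five_cycle_not_locating:
  assumes con: "connected_graph G" and loc: "edge_locating_coloring G k c"
    and V: "{w, x, y, z} \<subseteq> verts G" and dist: "distinct [v, w, x, y, z]"
    and E: "edges G = {{v, w}, {w, x}, {x, y}, {y, z}, {z, v}}"
    and c: "c {w, x} = c {y, z}" "c {x, y} = c {z, v}"
  shows False
proof -
  have "c ` edges G = {1..k}"
    using loc by (simp add: edge_locating_coloring_def proper_edge_coloring_def)
  then have image: "{1..k} = {c {v, w}, c {w, x}, c {x, y}}"
    unfolding E image_insert image_empty c by blast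
  have mem: "{v, w} \<in> edges G" "{w, x} \<in> edges G" "{x, y} \<in> edges G" "{y, z} \<in> edges G"
    unfolding E by simp_all
  have adj: "{x, w} \<in> edges G" "{z, v} \<in> edges G" "{z, y} \<in> edges G"
    unfolding E by (simp_all add: insert_commute)
  have "c ` {e \<in> edges G. x \<in> e} \<noteq> c ` {e \<in> edges G. z \<in> e}"
  proof (rule locating_distinguishes[OF con loc])
    show "x \<in> verts G" "z \<in> verts G" "x \<noteq> z" using V dist by auto
    have "{{v, w}, {w, x}, {x, y}} \<subseteq> {e \<in> edges G. \<exists>a\<in>e. x = a \<or> {x, a} \<in> edges G}"
      using mem adj by simp
    from image_mono[OF this, of c]
    show "{1..k} \<subseteq> c ` {e \<in> edges G. \<exists>a\<in>e. x = a \<or> {x, a} \<in> edges G}"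
      unfolding image by simp
    \<comment> \<open>The edge \<open>{w, x}\<close> is too far from \<open>z\<close>, so the
      incident edge \<open>{y, z}\<close> of the same color replaces it.\<close>
    have "{{v, w}, {y, z}, {x, y}} \<subseteq> {e \<in> edges G. \<exists>a\<in>e. z = a \<or> {z, a} \<in> edges G}"
      using mem adj by simp
    from image_mono[OF this, of c]
    show "{1..k} \<subseteq> c ` {e \<in> edges G. \<exists>a\<in>e. z = a \<or> {z, a} \<in> edges G}"
      unfolding image c(1) by simp
  qed
  moreover have "{e \<in> edges G. x \<in> e} = {{w, x}, {x, y}}" "{e \<in> edges G. z \<in> e} = {{y, z}, {z, v}}"
    using dist unfolding E by auto
  ultimately show False using c by simp
qed

text \<open>Each color occurs at most twice on five cyclically arranged edges, so the class sizes
  are 2, 2, 1. Dropping the edge with the single color leaves a path of four edges on which two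
  colors alternate; the disjuncts drop \<open>a\<close>, \<open>b\<close>, \<open>c\<close>,
  \<open>d\<close>, \<open>e\<close> in turn.\<close>

lemma five_cycle_three_colors:
  fixes a b c d e :: nat
  assumes "a \<in> {1..3}" "b \<in> {1..3}" "c \<in> {1..3}" "d \<in> {1..3}" "e \<in> {1..3}"
    and "a \<noteq> b" "b \<noteq> c" "c \<noteq> d" "d \<noteq> e" "e \<noteq> a"
  shows "b = d \<and> c = e \<or> c = e \<and> d = a \<or> d = a \<and> e = b \<or> e = b \<and> a = c \<or> a = c \<and> b = d"
proof -
  have "x = 1 \<or> x = 2 \<or> x = 3" if "x \<in> {1..3}" for x :: nat using that by auto
  then show ?thesis using assms by metis
qed

lemma cycle_5_colors:
  assumes loc: "edge_locating_coloring (cycle_graph 5) k c"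
  shows "4 \<le> k"
proof (rule ccontr)
  assume "\<not> 4 \<le> k"
  then have k: "k \<le> 3" by simp
  note con = connected_cycle_5
  have V: "verts (cycle_graph 5) = {..<5}" by (simp add: cycle_graph_def)
  have proper: "proper_edge_coloring (cycle_graph 5) k c"
    using loc by (simp add: edge_locating_coloring_def)
  then have im: "c ` edges (cycle_graph 5) \<subseteq> {1..k}"
    and ne: "\<And>e f. e \<in> edges (cycle_graph 5) \<Longrightarrow> f \<in> edges (cycle_graph 5) \<Longrightarrow>
      e \<noteq> f \<Longrightarrow> e \<inter> f \<noteq> {} \<Longrightarrow> c e \<noteq> c f"
    by (auto simp: proper_edge_coloring_def)
  define a0 where "a0 = c {0, 1}"
  define a1 where "a1 = c {1, 2}"
  define a2 where "a2 = c {2, 3}"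
  define a3 where "a3 = c {3, 4}"
  define a4 where "a4 = c {4, 0}"
  note a = a0_def a1_def a2_def a3_def a4_def
  have range: "a0 \<in> {1..3}" "a1 \<in> {1..3}" "a2 \<in> {1..3}" "a3 \<in> {1..3}" "a4 \<in> {1..3}"
    using im k unfolding edges_cycle_5 a by auto
  have adj: "a0 \<noteq> a1" "a1 \<noteq> a2" "a2 \<noteq> a3" "a3 \<noteq> a4" "a4 \<noteq> a0"
    unfolding a by (rule ne; simp add: edges_cycle_5 doubleton_eq_iff)+
  \<comment> \<open>The five rotations follow. The values instantiate \<open>w\<close>,
    \<open>x\<close>, \<open>y\<close>, \<open>z\<close>, \<open>v\<close> in this order, so the
    edge \<open>{v, w}\<close> has color \<open>a0\<close> here, then \<open>a1\<close>, and so
    on.\<close>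
  have "\<not> (a1 = a3 \<and> a2 = a4)"
    using five_cycle_not_locating[OF con loc, of 1 2 3 4 0] V
    unfolding edges_cycle_5 a by (auto simp: insert_commute)
  moreover have "\<not> (a2 = a4 \<and> a3 = a0)"
    using five_cycle_not_locating[OF con loc, of 2 3 4 0 1] V
    unfolding edges_cycle_5 a by (auto simp: insert_commute)
  moreover have "\<not> (a3 = a0 \<and> a4 = a1)"
    using five_cycle_not_locating[OF con loc, of 3 4 0 1 2] V
    unfolding edges_cycle_5 a by (auto simp: insert_commute)
  moreover have "\<not> (a4 = a1 \<and> a0 = a2)"
    using five_cycle_not_locating[OF con loc, of 4 0 1 2 3] V
    unfolding edges_cycle_5 a by (auto simp: insert_commute)
  moreover have "\<not> (a0 = a2 \<and> a1 = a3)"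
    using five_cycle_not_locating[OF con loc, of 0 1 2 3 4] V
    unfolding edges_cycle_5 a by (auto simp: insert_commute)
  ultimately show False using five_cycle_three_colors[OF range adj] by blast
qed

lemma attains_cycle_5: "attains_matching_bound (cycle_graph 5)"
proof (rule attains_matching_boundI[where M = "{{0, 1}, {2, 3}}" and s = 2])
  show con: "connected_graph (cycle_graph 5)" by (rule connected_cycle_5)
  show "5 \<le> card (verts (cycle_graph 5))" by (simp add: cycle_graph_def)
  show "matching (cycle_graph 5) {{0, 1}, {2, 3}}"
    unfolding matching_def edges_cycle_5 by (simp add: pairwise_insert)
  show "card {{0, 1}, {2, 3 :: nat}} = 2" by (simp add: doubleton_eq_iff)
  show "card M' \<le> 2" if "matching (cycle_graph 5) M'" for M'
    using double_card_matching_le[OF con that] by (simp add: cycle_graph_def)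
  have "card (edges (cycle_graph 5)) = 5"
    unfolding edges_cycle_5 by (simp add: doubleton_eq_iff)
  then show "card (edges (cycle_graph 5)) - 2 + 1 \<le> k"
    if "edge_locating_coloring (cycle_graph 5) k c" for k c
    using cycle_5_colors[OF that] by simp
qed

text \<open>With at most two colors, the inner vertices 1 and 2 are each incident with every color,
  so both codes are all zero.\<close>

lemma path_5_colors:
  assumes loc: "edge_locating_coloring (path_graph 5) k c"
  shows "3 \<le> k"
proof (rule ccontr)
  assume "\<not> 3 \<le> k"
  then have k: "k \<le> 2" by simp
  have con: "connected_graph (path_graph 5)" by (rule connected_path) simp
  have proper: "proper_edge_coloring (path_graph 5) k c"
    using loc by (simp add: edge_locating_coloring_def)
  then have im: "c ` edges (path_graph 5) \<subseteq> {1..k}"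
    and ne: "\<And>e f. e \<in> edges (path_graph 5) \<Longrightarrow> f \<in> edges (path_graph 5) \<Longrightarrow>
      e \<noteq> f \<Longrightarrow> e \<inter> f \<noteq> {} \<Longrightarrow> c e \<noteq> c f"
    by (auto simp: proper_edge_coloring_def)
  have c01: "c {0, 1} \<noteq> c {1, 2}" and c12: "c {1, 2} \<noteq> c {2, 3}"
    by (rule ne; simp add: edges_path_5 doubleton_eq_iff)+
  have ck: "c {0, 1} \<in> {1..k}" "c {1, 2} \<in> {1..k}" "c {2, 3} \<in> {1..k}"
    using im unfolding edges_path_5 by auto
  have pair: "{1..k} = {a, b}" if "a \<in> {1..k}" "b \<in> {1..k}" "a \<noteq> b" for a b
    using card_seteq[of "{1..k}" "{a, b}"] that k by simp
  have two: "{1..k} = c ` {{0, 1}, {1, 2}}" "{1..k} = c ` {{1, 2}, {2, 3}}"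
    using pair[OF ck(1,2) c01] pair[OF ck(2,3) c12] by simp_all
  have inc: "{e \<in> edges (path_graph 5). 1 \<in> e} = {{0, 1}, {1, 2}}"
    "{e \<in> edges (path_graph 5). 2 \<in> e} = {{1, 2}, {2, 3}}"
    unfolding edges_path_5 by auto
  have "c ` {e \<in> edges (path_graph 5). 1 \<in> e} \<noteq> c ` {e \<in> edges (path_graph 5). 2 \<in> e}"
  proof (rule locating_distinguishes[OF con loc])
    show "1 \<in> verts (path_graph 5)" "2 \<in> verts (path_graph 5)" "1 \<noteq> (2 :: nat)"
      by (simp_all add: path_graph_def)
    show "{1..k} \<subseteq> c ` {e \<in> edges (path_graph 5). \<exists>x\<in>e. 1 = x \<or> {1, x} \<in> edges (path_graph 5)}"
      unfolding two(1) edges_path_5 by (rule image_mono) simp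
    show "{1..k} \<subseteq> c ` {e \<in> edges (path_graph 5). \<exists>x\<in>e. 2 = x \<or> {2, x} \<in> edges (path_graph 5)}"
      unfolding two(2) edges_path_5 by (rule image_mono) simp
  qed
  moreover have "c ` {e \<in> edges (path_graph 5). 1 \<in> e} =
      c ` {e \<in> edges (path_graph 5). 2 \<in> e}"
    unfolding inc by (rule trans[OF two(1)[symmetric] two(2)])
  ultimately show False by contradiction
qed

lemma attains_path_5: "attains_matching_bound (path_graph 5)"
proof (rule attains_matching_boundI[where M = "{{0, 1}, {2, 3}}" and s = 2])
  show con: "connected_graph (path_graph 5)" by (rule connected_path) simp
  show "5 \<le> card (verts (path_graph 5))" by (simp add: path_graph_def)
  show "matching (path_graph 5) {{0, 1}, {2, 3}}"
    unfolding matching_def edges_path_5 by (simp add: pairwise_insert)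
  show "card {{0, 1}, {2, 3 :: nat}} = 2" by (simp add: doubleton_eq_iff)
  show "card M' \<le> 2" if "matching (path_graph 5) M'" for M'
    using double_card_matching_le[OF con that] by (simp add: path_graph_def)
  have "card (edges (path_graph 5)) = 4"
    unfolding edges_path_5 by (simp add: doubleton_eq_iff)
  then show "card (edges (path_graph 5)) - 2 + 1 \<le> k"
    if "edge_locating_coloring (path_graph 5) k c" for k c
    using path_5_colors[OF that] by simp
qed

section \<open>Stars and double stars\<close>

lemma card_spokes: "card ((\<lambda>i. {0, i}) ` {a..<b :: nat}) = b - a"
  by (subst card_image) (auto simp: inj_on_def doubleton_eq_iff)

lemma edges_star: "edges (star_graph q) = (\<lambda>i. {0, i}) ` {1..<Suc q}"
  by (auto simp: star_graph_def)

text \<open>The center covers all edges, so the matching number is 1 and the bound equals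
  \<open>q\<close>, which is also the degree of the center.\<close>

lemma attains_star:
  assumes "q \<ge> 4"
  shows "attains_matching_bound (star_graph q)"
proof (rule attains_matching_boundI[where M = "{{0, 1}}" and s = 1])
  show "connected_graph (star_graph q)"
  proof (rule connected_graphI[where r = 0])
    show "simple_graph (star_graph q)" by (force simp: simple_graph_def star_graph_def)
    show "0 \<in> verts (star_graph q)" by (simp add: star_graph_def)
    show "(0, v) \<in> (adj_rel (star_graph q))\<^sup>*" if "v \<in> verts (star_graph q)" for v
    proof (cases "v = 0")
      case False
      then have "(0, v) \<in> adj_rel (star_graph q)"
        using that by (auto simp: adj_rel_def star_graph_def)
      then show ?thesis by blast
    qed simp
  qed
  show "5 \<le> card (verts (star_graph q))" using assms by (simp add: star_graph_def)
  show "matching (star_graph q) {{0, 1}}" using assms by (auto simp: matching_def edges_star)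
  show "card M' \<le> 1" if "matching (star_graph q) M'" for M'
    using card_matching_le_cover[OF that, of "{0}"] by (auto simp: edges_star)
  show "card (edges (star_graph q)) - 1 + 1 \<le> k" if "edge_locating_coloring (star_graph q) k c" for k c
  proof -
    have "card (edges (star_graph q)) \<le> k"
      using that degree_le_colors[of "star_graph q" k c "edges (star_graph q)" 0]
      by (auto simp: edge_locating_coloring_def edges_star)
    moreover have "card (edges (star_graph q)) = q" unfolding edges_star card_spokes by simp
    ultimately show ?thesis using assms by simp
  qed
qed simp

text \<open>Counting the edge between the centers as a spoke collects all \<open>p + 1\<close> edges
  at 0 in one image set; a single pendant edge at 1 remains.\<close>

lemma edges_double_star:
  "edges (double_star p 1) = insert {1, p + 2} ((\<lambda>i. {0, i}) ` {1..<p + 2})"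
proof -
  have "edges (double_star p 1) =
      insert {1, p + 2} ((\<lambda>i. {0, i}) ` insert 1 {2..<p + 2})"
    by (auto simp: double_star_def)
  also have "insert 1 {2..<p + 2} = {1..<p + 2}" by auto
  finally show ?thesis .
qed

text \<open>The order is \<open>p + 3\<close>, so \<open>p \<ge> 2\<close> expresses order at least
  five. The two centers cover all edges, so the matching number is 2, and with \<open>p + 2\<close>
  edges the bound is \<open>p + 1\<close>, the degree of 0.\<close>

lemma attains_double_star:
  assumes "p \<ge> 2"
  shows "attains_matching_bound (double_star p 1)"
proof (rule attains_matching_boundI[where M = "{{0, 2}, {1, p + 2}}" and s = 2])
  let ?G = "double_star p 1"
  have V: "verts ?G = {..<p + 3}" by (simp add: double_star_def)
  show "connected_graph ?G"
  proof (rule connected_graphI[where r = 0])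
    show "simple_graph ?G"
      unfolding simple_graph_def edges_double_star V by force
    show "0 \<in> verts ?G" unfolding V by simp
    have spoke: "(0, v) \<in> (adj_rel ?G)\<^sup>*" if "v \<in> {1..<p + 2}" for v
      using that unfolding adj_rel_def edges_double_star by blast
    have "(1, p + 2) \<in> adj_rel ?G" unfolding adj_rel_def edges_double_star by blast
    then have "(0, p + 2) \<in> (adj_rel ?G)\<^sup>*"
      using spoke[of 1] rtrancl.rtrancl_into_rtrancl by force
    moreover have "v = 0 \<or> v \<in> {1..<p + 2} \<or> v = p + 2" if "v \<in> verts ?G" for v
      using that unfolding V by auto
    ultimately show "(0, v) \<in> (adj_rel ?G)\<^sup>*" if "v \<in> verts ?G" for v
      using spoke that by blast
  qed
  show "5 \<le> card (verts ?G)" unfolding V using assms by simp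
  show "matching ?G {{0, 2}, {1, p + 2}}"
    using assms unfolding matching_def edges_double_star by (auto simp: pairwise_insert)
  show "card {{0, 2}, {1, p + 2}} = 2" by (simp add: doubleton_eq_iff)
  have "e \<inter> {0, 1} \<noteq> {}" if "e \<in> edges ?G" for e
    using that unfolding edges_double_star by auto
  then show "card M' \<le> 2" if "matching ?G M'" for M'
    using card_matching_le_cover[OF that, of "{0, 1}"] by simp
  show "card (edges ?G) - 2 + 1 \<le> k" if "edge_locating_coloring ?G k c" for k c
  proof -
    let ?F = "(\<lambda>i. {0, i}) ` {1..<p + 2}"
    have "?F \<subseteq> edges ?G" unfolding edges_double_star by blast
    then have "card ?F \<le> k"
      using that degree_le_colors[of ?G k c ?F 0] by (auto simp: edge_locating_coloring_def)
    \<comment> \<open>The pendant edge at 1 misses 0, so the total number of edges is one more than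
      the degree of 0.\<close>
    moreover have "{1, p + 2} \<notin> ?F" by (auto simp: doubleton_eq_iff)
    then have "card (edges ?G) = Suc (card ?F)" unfolding edges_double_star by simp
    ultimately show ?thesis unfolding card_spokes by simp
  qed
qed

theorem theorem14:
  "(\<forall>(G :: 'a ugraph) M n m k.
      connected_graph G \<and> card (verts G) = n \<and> n \<ge> 5 \<and> card (edges G) = m \<and>
      maximum_matching G M \<and> card M = k
      \<longrightarrow> edge_locating_chromatic_number G \<le> m - k + 1) \<and>
   attains_matching_bound (cycle_graph 5) \<and>
   attains_matching_bound (path_graph 5) \<and>
   (\<forall>n\<ge>5. attains_matching_bound (star_graph (n - 1))) \<and>
   (\<forall>p\<ge>2. attains_matching_bound (double_star p 1))"
proof (intro conjI allI impI)
  fix G :: "'a ugraph" and M n m k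
  assume "connected_graph G \<and> card (verts G) = n \<and> n \<ge> 5 \<and> card (edges G) = m \<and>
    maximum_matching G M \<and> card M = k"
  then show "edge_locating_chromatic_number G \<le> m - k + 1"
    unfolding edge_locating_chromatic_number_def
    using exists_edge_locating_coloring[of G M] by (auto intro: Least_le)
next
  fix n :: nat assume "n \<ge> 5"
  then show "attains_matching_bound (star_graph (n - 1))" by (intro attains_star) simp
qed (use attains_cycle_5 attains_path_5 attains_double_star in auto)

end
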